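(* Let $f\colon\mathbb R^n\to\mathbb R$ and $F\colon\mathbb R^n\to\mathbb R^m$ be twice continuously differentiable, let $D_1,\ldots,D_r\subset\mathbb R^m$ be polyhedral sets, $D:=\bigcup_{i=1}^r D_i$, and $X:=\{x\in\mathbb R^n\,|\,F(x)\in D\}$. Let $\bar x\in X$ be an S-stationary point of the problem of minimizing $f(x)$ subject to $F(x)\in D$ such that \[ \forall d\in\mathcal C_X(\bar x)\setminus\{0\}\ \exists\lambda\in S(\bar x)\colon\quad d^\top\nabla^2_{xx}L(\bar x,\lambda)\,d>0. \] Then there are constants $\varepsilon>0$ and $C>0$ such that \[ \forall x\in X \text{ with } \|x-\bar x\|_2\le\varepsilon\colon\quad f(x)\ge f(\bar x)+C\|x-\bar x\|_2^2. \] In particular, $\bar x$ is a strict local minimizer of $f$ over $X$.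
   Context: A set is polyhedral if it is the intersection of finitely many (closed) half spaces. $\nabla F(x)\in\mathbb R^{m\times n}$ denotes the Jacobian, $\nabla f(x)$ the gradient. For a closed set $A\subset\mathbb R^m$ and $y\in A$, the tangent (Bouligand) cone is $\mathcal T_A(y):=\{d\,|\,\exists t_k\downarrow 0,\ \exists d_k\to d:\ y+t_kd_k\in A\ \forall k\}$, and the Fréchet normal cone is $\widehat{\mathcal N}_A(y):=\{\eta\,|\,\eta\cdot d\le 0\ \forall d\in\mathcal T_A(y)\}$. For $\bar x\in X$, $I(\bar x):=\{i\in\{1,\ldots,r\}\,|\,F(\bar x)\in D_i\}$. The Lagrangian is $L(x,\lambda):=f(x)+F(x)\cdot\lambda$ for $(x,\lambda)\in\mathbb R^n\times\mathbb R^m$. The linearization cone is $\mathcal L_X(\bar x):=\{d\in\mathbb R^n\,|\,\nabla F(\bar x)d\in\mathcal T_D(F(\bar x))\}$ and the critical cone is $\mathcal C_X(\bar x):=\{d\in\mathcal L_X(\bar x)\,|\,\nabla f(\bar x)\cdot d\le 0\}$. $S(\bar x):=\{\lambda\in\bigcap_{i\in I(\bar x)}\widehat{\mathcal N}_{D_i}(F(\bar x))\,|\,\nabla_xL(\bar x,\lambda)=0\}$, and $\bar x\in X$ is called S-stationary (strongly stationary) if $S(\bar x)\ne\varnothing$. *)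

theory Defs
  imports "HOL-Analysis.Analysis"
begin

definition twice_continuously_differentiable ::
    "('a::real_normed_vector \<Rightarrow> 'b::real_normed_vector) \<Rightarrow> bool" where
  "twice_continuously_differentiable g \<longleftrightarrow>
     (\<exists>(g' :: 'a \<Rightarrow> 'a \<Rightarrow>\<^sub>L 'b) (g'' :: 'a \<Rightarrow> 'a \<Rightarrow>\<^sub>L 'a \<Rightarrow>\<^sub>L 'b).
        (\<forall>x. (g has_derivative blinfun_apply (g' x)) (at x)) \<and>
        (\<forall>x. (g' has_derivative blinfun_apply (g'' x)) (at x)) \<and>
        continuous_on UNIV g'')"

text \<open>Meaningful only where \<open>g\<close> is differentiable; there the vector is unique.\<close>

definition gradient :: "(real ^ 'n \<Rightarrow> real) \<Rightarrow> real ^ 'n \<Rightarrow> real ^ 'n" where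
  "gradient g x = (THE v. GDERIV g x :> v)"

lemma gradient_eqI:
  fixes g :: "real ^ 'n \<Rightarrow> real"
  assumes "GDERIV g x :> v"
  shows "gradient g x = v"
  unfolding gradient_def
proof (rule the_equality)
  show "GDERIV g x :> v" by (fact assms)
next
  fix w assume "GDERIV g x :> w"
  with assms have "(\<lambda>h. inner h w) = (\<lambda>h. inner h v)"
    unfolding gderiv_def by (rule has_derivative_unique[rotated])
  then have "inner h w = inner h v" for h
    by (rule fun_cong)
  then show "w = v"
    by (metis inner_commute vector_eq_ldot)
qed

definition hessian :: "(real ^ 'n \<Rightarrow> real) \<Rightarrow> real ^ 'n \<Rightarrow> real ^ 'n ^ 'n" where
  "hessian g x = jacobian (gradient g) (at x)"

text \<open>
  Bouligand cone. As usual, \<open>t\<^sub>k \<down> 0\<close> is read as \<open>t\<^sub>k > 0\<close> and \<open>t\<^sub>k \<rightarrow> 0\<close>; requiring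
  monotonicity as well gives the same cone, by passing to a subsequence.
\<close>

definition tangent_cone :: "'a::real_normed_vector set \<Rightarrow> 'a \<Rightarrow> 'a set" where
  "tangent_cone A y =
     {d. \<exists>(t :: nat \<Rightarrow> real) (e :: nat \<Rightarrow> 'a).
           (\<forall>k. t k > 0) \<and> t \<longlonglongrightarrow> 0 \<and> e \<longlonglongrightarrow> d \<and> (\<forall>k. y + t k *\<^sub>R e k \<in> A)}"

definition frechet_normal_cone :: "'a::real_inner set \<Rightarrow> 'a \<Rightarrow> 'a set" where
  "frechet_normal_cone A y = {\<eta>. \<forall>d\<in>tangent_cone A y. \<eta> \<bullet> d \<le> 0}"

definition feasible_set :: "('a \<Rightarrow> 'b) \<Rightarrow> 'b set \<Rightarrow> 'a set" where
  "feasible_set F A = {x. F x \<in> A}"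

definition active_indices ::
    "('a \<Rightarrow> 'b) \<Rightarrow> (nat \<Rightarrow> 'b set) \<Rightarrow> nat \<Rightarrow> 'a \<Rightarrow> nat set" where
  "active_indices F D r x = {i \<in> {1..r}. F x \<in> D i}"

definition lagrangian ::
    "(real ^ 'n \<Rightarrow> real) \<Rightarrow> (real ^ 'n \<Rightarrow> real ^ 'm) \<Rightarrow> real ^ 'n \<Rightarrow> real ^ 'm \<Rightarrow> real" where
  "lagrangian f F x \<mu> = f x + F x \<bullet> \<mu>"

definition linearization_cone ::
    "(real ^ 'n \<Rightarrow> real ^ 'm) \<Rightarrow> (real ^ 'm) set \<Rightarrow> real ^ 'n \<Rightarrow> (real ^ 'n) set" where
  "linearization_cone F A x = {d. jacobian F (at x) *v d \<in> tangent_cone A (F x)}"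

definition critical_cone ::
    "(real ^ 'n \<Rightarrow> real) \<Rightarrow> (real ^ 'n \<Rightarrow> real ^ 'm) \<Rightarrow> (real ^ 'm) set \<Rightarrow> real ^ 'n
      \<Rightarrow> (real ^ 'n) set" where
  "critical_cone f F A x = {d \<in> linearization_cone F A x. gradient f x \<bullet> d \<le> 0}"

definition S_multipliers ::
    "(real ^ 'n \<Rightarrow> real) \<Rightarrow> (real ^ 'n \<Rightarrow> real ^ 'm) \<Rightarrow> (nat \<Rightarrow> (real ^ 'm) set) \<Rightarrow> nat
      \<Rightarrow> real ^ 'n \<Rightarrow> (real ^ 'm) set" where
  "S_multipliers f F D r x =
     {\<mu> \<in> (\<Inter>i\<in>active_indices F D r x. frechet_normal_cone (D i) (F x)).
        gradient (\<lambda>z. lagrangian f F z \<mu>) x = 0}"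

definition S_stationary ::
    "(real ^ 'n \<Rightarrow> real) \<Rightarrow> (real ^ 'n \<Rightarrow> real ^ 'm) \<Rightarrow> (nat \<Rightarrow> (real ^ 'm) set) \<Rightarrow> nat
      \<Rightarrow> real ^ 'n \<Rightarrow> bool" where
  "S_stationary f F D r x \<longleftrightarrow>
     x \<in> feasible_set F (\<Union>i\<in>{1..r}. D i) \<and> S_multipliers f F D r x \<noteq> {}"

definition strict_local_minimizer ::
    "('a::metric_space \<Rightarrow> real) \<Rightarrow> 'a set \<Rightarrow> 'a \<Rightarrow> bool" where
  "strict_local_minimizer f X x \<longleftrightarrow>
     x \<in> X \<and> (\<exists>\<delta>>0. \<forall>y\<in>X. y \<noteq> x \<and> dist y x < \<delta> \<longrightarrow> f x < f y)"

end

theory Submission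
  imports Defs
begin

text \<open>
  If quadratic growth fails, there are feasible \<open>x\<^sub>k \<rightarrow> xbar\<close> violating it with constants \<open>1/k\<close>,
  and the normalised steps have a limit direction \<open>d \<noteq> 0\<close>, which is critical. Take the multiplier
  \<open>\<mu>\<close> that SOSC provides for \<open>d\<close>. For large \<open>k\<close> the point \<open>F x\<^sub>k\<close> lies in a piece that is active
  at \<open>xbar\<close>, so convexity of the piece gives \<open>\<mu> \<bullet> (F x\<^sub>k - F xbar) \<le> 0\<close>. The increase of \<open>f\<close> thus
  dominates that of the Lagrangian, whose second order expansion at its critical point \<open>xbar\<close>
  contradicts the choice of \<open>x\<^sub>k\<close>.
\<close>

text \<open>The quotient splits into \<open>g'\<close> of the normalised step, which tends to
  \<open>g' d\<close> by continuity of \<open>g'\<close>, and the first order remainder divided by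
  the step length, which tends to 0. Used for both \<open>F\<close> and \<open>f\<close> along the
  same sequence.\<close>

lemma directional_difference_quotient_tendsto:
  assumes g: "(g has_derivative g') (at x)"
    and y: "y \<longlonglongrightarrow> x" "\<And>n. y n \<noteq> x"
    and d: "(\<lambda>n. (y n - x) /\<^sub>R norm (y n - x)) \<longlonglongrightarrow> d"
  shows "(\<lambda>n. (g (y n) - g x) /\<^sub>R norm (y n - x)) \<longlonglongrightarrow> g' d"
proof -
  interpret g': bounded_linear g'
    using g by (rule has_derivative_bounded_linear)
  have "filterlim y (at x) sequentially"
    using y by (simp add: filterlim_at)
  moreover have "((\<lambda>z. ((g z - g x) - g' (z - x)) /\<^sub>R norm (z - x)) \<longlongrightarrow> 0) (at x)"
    using g by (simp add: has_derivative_at_within)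
  ultimately have "(\<lambda>n. ((g (y n) - g x) - g' (y n - x)) /\<^sub>R norm (y n - x)) \<longlonglongrightarrow> 0"
    by (rule filterlim_compose[rotated])
  from tendsto_add[OF this g'.tendsto[OF d]] show ?thesis
    by (simp add: g'.scaleR flip: scaleR_add_right)
qed

text \<open>Comparing along segments avoids any appeal to the symmetry of \<open>H\<close>.\<close>

lemma second_order_expansion_at_critical_point:
  fixes g :: "'a::real_inner \<Rightarrow> real"
  assumes g: "\<And>z. GDERIV g z :> G z"
    and crit: "G x = 0"
    and G: "(G has_derivative H) (at x)"
    and "e > 0"
  obtains \<delta> where "\<delta> > 0"
    "\<And>z. norm (z - x) < \<delta> \<Longrightarrow> \<bar>g z - g x - ((z - x) \<bullet> H (z - x)) / 2\<bar> \<le> e * (norm (z - x))\<^sup>2"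
proof -
  interpret H: bounded_linear H
    using G by (rule has_derivative_bounded_linear)
  obtain \<delta> where \<delta>: "\<delta> > 0"
    "\<And>z. norm (z - x) < \<delta> \<Longrightarrow> norm (G z - G x - H (z - x)) \<le> e * norm (z - x)"
    using G \<open>e > 0\<close> unfolding has_derivative_at_alt by blast
  show thesis
  proof (rule that[OF \<open>\<delta> > 0\<close>])
    fix z assume z: "norm (z - x) < \<delta>"
    define h where "h = z - x"
    \<comment> \<open>\<open>q\<close> is \<open>g\<close> along the segment minus the quadratic
      model, so \<open>q 1 - q 0\<close> is the error to be bounded. Its derivative at
      \<open>s\<close> is \<open>h\<close> paired with
      \<open>G (x + s *\<^sub>R h) - H (s *\<^sub>R h)\<close>, and by \<open>crit\<close> the
      second factor is the first order remainder of \<open>G\<close> at \<open>x\<close>.\<close>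
    define q where "q s = g (x + s *\<^sub>R h) - s\<^sup>2 / 2 * (h \<bullet> H h)" for s
    have deriv: "(q has_real_derivative (h \<bullet> G (x + s *\<^sub>R h) - s * (h \<bullet> H h))) (at s)" for s
    proof -
      have "((\<lambda>s. x + s *\<^sub>R h) has_derivative (\<lambda>s. s *\<^sub>R h)) (at s)"
        by (auto intro!: derivative_eq_intros)
      from has_derivative_compose[OF this g[unfolded gderiv_def]]
      have "((\<lambda>s. g (x + s *\<^sub>R h)) has_real_derivative (h \<bullet> G (x + s *\<^sub>R h))) (at s)"
        by (simp add: has_field_derivative_def mult.commute[of _ "_ \<bullet> _"])
      then show ?thesis
        unfolding q_def by (auto intro!: derivative_eq_intros)
    qed
    have "norm (q 1 - q 0) \<le> (e * (norm h)\<^sup>2) * norm (1 - 0 :: real)"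
    proof (rule field_differentiable_bound[of "{0..1}"])
      show "(q has_real_derivative (h \<bullet> G (x + s *\<^sub>R h) - s * (h \<bullet> H h))) (at s within {0..1})" for s
        using deriv by (rule has_field_derivative_at_within)
      fix s :: real assume s: "s \<in> {0..1}"
      then have le: "norm (s *\<^sub>R h) \<le> norm h"
        by (simp add: mult_left_le_one_le)
      have "norm (G (x + s *\<^sub>R h) - H (s *\<^sub>R h)) \<le> e * norm (s *\<^sub>R h)"
        using \<delta>(2)[of "x + s *\<^sub>R h"] le z by (simp add: crit h_def)
      also have "\<dots> \<le> e * norm h"
        using le \<open>e > 0\<close> by simp
      finally have le': "norm (G (x + s *\<^sub>R h) - H (s *\<^sub>R h)) \<le> e * norm h" .
      have "norm (h \<bullet> G (x + s *\<^sub>R h) - s * (h \<bullet> H h)) = \<bar>h \<bullet> (G (x + s *\<^sub>R h) - H (s *\<^sub>R h))\<bar>"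
        by (simp add: H.scaleR inner_diff_right)
      also have "\<dots> \<le> norm h * norm (G (x + s *\<^sub>R h) - H (s *\<^sub>R h))"
        by (rule Cauchy_Schwarz_ineq2)
      also have "\<dots> \<le> norm h * (e * norm h)"
        using le' by (rule mult_left_mono) simp
      finally show "norm (h \<bullet> G (x + s *\<^sub>R h) - s * (h \<bullet> H h)) \<le> e * (norm h)\<^sup>2"
        by (simp add: power2_eq_square mult_ac)
    qed auto
    moreover have "q 1 - q 0 = g z - g x - (h \<bullet> H h) / 2"
      by (simp add: q_def h_def)
    ultimately show "\<bar>g z - g x - ((z - x) \<bullet> H (z - x)) / 2\<bar> \<le> e * (norm (z - x))\<^sup>2"
      by (simp add: h_def)
  qed
qed

lemma twice_continuously_differentiable_imp_has_derivative:
  assumes "twice_continuously_differentiable g"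
  obtains g' where "(g has_derivative g') (at x)"
  using assms unfolding twice_continuously_differentiable_def by blast

text \<open>Smoothness is stated with operator-valued derivatives, the second order condition with
  \<open>gradient\<close> and \<open>hessian\<close>. This bridge makes sure that both describe true
  derivatives of the Lagrangian.\<close>

lemma twice_continuously_differentiable_lagrangian:
  fixes f :: "real ^ 'n \<Rightarrow> real" and F :: "real ^ 'n \<Rightarrow> real ^ 'm"
  assumes "twice_continuously_differentiable f" "twice_continuously_differentiable F"
  shows "GDERIV (\<lambda>z. lagrangian f F z \<mu>) x :> gradient (\<lambda>z. lagrangian f F z \<mu>) x"
    and "gradient (\<lambda>z. lagrangian f F z \<mu>) differentiable at x"
proof -
  obtain f' f'' where f': "\<And>x. (f has_derivative blinfun_apply (f' x)) (at x)"
    and f'': "\<And>x. (f' has_derivative blinfun_apply (f'' x)) (at x)"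
    using assms(1) unfolding twice_continuously_differentiable_def by blast
  obtain F' F'' where F': "\<And>x. (F has_derivative blinfun_apply (F' x)) (at x)"
    and F'': "\<And>x. (F' has_derivative blinfun_apply (F'' x)) (at x)"
    using assms(2) unfolding twice_continuously_differentiable_def by blast
  \<comment> \<open>The Riesz representative of the derivative of the Lagrangian, written in
    coordinates so that its differentiability reduces to that of scalar coefficients.\<close>
  define G where "G x = (\<Sum>b\<in>Basis. (f' x b + F' x b \<bullet> \<mu>) *\<^sub>R b)" for x
  have G: "GDERIV (\<lambda>z. lagrangian f F z \<mu>) x :> G x" for x
  proof -
    have "h \<bullet> G x = f' x h + F' x h \<bullet> \<mu>" for h
    proof -
      have lin: "linear (\<lambda>h. f' x h + F' x h \<bullet> \<mu>)"
        by (intro linearI) (simp_all add: blinfun.bilinear_simps algebra_simps)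
      have "f' x h + F' x h \<bullet> \<mu> = (\<Sum>b\<in>Basis. (h \<bullet> b) *\<^sub>R (f' x b + F' x b \<bullet> \<mu>))"
        using Linear_Algebra.linear_componentwise[OF lin, of h 1] by simp
      then show ?thesis
        by (simp add: G_def inner_sum_right mult.commute)
    qed
    moreover have "((\<lambda>z. lagrangian f F z \<mu>) has_derivative (\<lambda>h. f' x h + F' x h \<bullet> \<mu>)) (at x)"
      unfolding lagrangian_def by (intro has_derivative_add has_derivative_inner_left f' F')
    ultimately show ?thesis
      unfolding gderiv_def by simp
  qed
  then have grad: "gradient (\<lambda>z. lagrangian f F z \<mu>) = G"
    by (auto simp: gradient_eqI)
  show "GDERIV (\<lambda>z. lagrangian f F z \<mu>) x :> gradient (\<lambda>z. lagrangian f F z \<mu>) x"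
    unfolding grad by (rule G)
  \<comment> \<open>Evaluation at a fixed \<open>b\<close> is bounded linear on operators, so the
    chain rule applies to \<open>f'\<close> and \<open>F'\<close>.\<close>
  have "(\<lambda>x. f' x b) differentiable at x" "(\<lambda>x. F' x b) differentiable at x" for b
    using bounded_linear.has_derivative[OF blinfun.bounded_linear_left f'']
      bounded_linear.has_derivative[OF blinfun.bounded_linear_left F'']
    unfolding differentiable_def by blast+
  then show "gradient (\<lambda>z. lagrangian f F z \<mu>) differentiable at x"
    unfolding grad G_def by (auto intro!: differentiable_sum differentiable_scaleR
      differentiable_add differentiable_inner)
qed

text \<open>The segment from \<open>y\<close> to \<open>z\<close> stays in \<open>A\<close>, so a
  constant direction and step sizes in \<open>(0, 1]\<close> are witnesses. Hence a Frechet normal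
  to a convex set satisfies its inequality on the whole set.\<close>

lemma tangent_cone_convex:
  assumes "convex A" "y \<in> A" "z \<in> A"
  shows "z - y \<in> tangent_cone A y"
proof -
  define t where "t k = 1 / real (Suc k)" for k
  have "y + t k *\<^sub>R (z - y) \<in> A" for k
    using convexD_alt[OF assms, of "t k"] by (simp add: t_def algebra_simps)
  moreover have "t \<longlonglongrightarrow> 0"
    unfolding t_def by (rule LIMSEQ_Suc[OF lim_1_over_n])
  ultimately show ?thesis
    unfolding tangent_cone_def by (intro CollectI exI[of _ t] exI[of _ "\<lambda>_. z - y"]) (simp add: t_def)
qed

lemma quadratic_growth_imp_strict_local_minimizer:
  fixes f :: "'a::real_normed_vector \<Rightarrow> real"
  assumes "x \<in> X" "\<epsilon> > 0" "C > 0"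
    and "\<And>z. z \<in> X \<Longrightarrow> norm (z - x) \<le> \<epsilon> \<Longrightarrow> f z \<ge> f x + C * (norm (z - x))\<^sup>2"
  shows "strict_local_minimizer f X x"
proof -
  have "f x < f z" if "z \<in> X" "z \<noteq> x" "dist z x < \<epsilon>" for z
  proof -
    have "C * (norm (z - x))\<^sup>2 > 0"
      using that \<open>C > 0\<close> by simp
    then show ?thesis
      using assms(4)[of z] that by (simp add: dist_norm)
  qed
  then show ?thesis
    unfolding strict_local_minimizer_def using assms by blast
qed

theorem theorem4p3:
  fixes f :: "real ^ 'n \<Rightarrow> real"
    and F :: "real ^ 'n \<Rightarrow> real ^ 'm"
    and Ds :: "nat \<Rightarrow> (real ^ 'm) set"
    and r :: nat
    and D :: "(real ^ 'm) set"
    and X :: "(real ^ 'n) set"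
    and xbar :: "real ^ 'n"
  assumes f_C2: "twice_continuously_differentiable f"
    and F_C2: "twice_continuously_differentiable F"
    and polyhedral: "\<forall>i\<in>{1..r}. polyhedron (Ds i)"
    and D_eq: "D = (\<Union>i\<in>{1..r}. Ds i)"
    and X_eq: "X = feasible_set F D"
    and xbar_feasible: "xbar \<in> X"
    and xbar_S_stationary: "S_stationary f F Ds r xbar"
    and SOSC: "\<forall>d \<in> critical_cone f F D xbar - {0}. \<exists>\<mu> \<in> S_multipliers f F Ds r xbar.
                 d \<bullet> (hessian (\<lambda>x. lagrangian f F x \<mu>) xbar *v d) > 0"
  shows "(\<exists>\<epsilon>>0. \<exists>C>0. \<forall>x\<in>X. norm (x - xbar) \<le> \<epsilon> \<longrightarrow>
             f x \<ge> f xbar + C * (norm (x - xbar))\<^sup>2)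
         \<and> strict_local_minimizer f X xbar"
proof -
  have "\<exists>\<epsilon>>0. \<exists>C>0. \<forall>x\<in>X. norm (x - xbar) \<le> \<epsilon> \<longrightarrow>
      f x \<ge> f xbar + C * (norm (x - xbar))\<^sup>2"
  proof (rule ccontr)
    assume no_growth: "\<not> ?thesis"
    \<comment> \<open>\<open>c k\<close> serves both as the radius and as the growth constant in the
      negated claim.\<close>
    define c where "c k = 1 / real (Suc k)" for k
    have c_pos: "c k > 0" for k
      by (simp add: c_def)
    have c_lim: "c \<longlonglongrightarrow> 0"
      unfolding c_def by (rule LIMSEQ_Suc[OF lim_1_over_n])
    have "\<exists>x\<in>X. norm (x - xbar) \<le> c k \<and> f x < f xbar + c k * (norm (x - xbar))\<^sup>2" for k
      using no_growth c_pos[of k] by (meson not_le)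
    then obtain w where w: "\<And>k. w k \<in> X" "\<And>k. norm (w k - xbar) \<le> c k"
      "\<And>k. f (w k) < f xbar + c k * (norm (w k - xbar))\<^sup>2"
      by metis
    \<comment> \<open>At \<open>xbar\<close> the strict inequality would read
      \<open>f xbar < f xbar\<close>.\<close>
    have w_ne: "w k \<noteq> xbar" for k
      using w(3)[of k] by auto
    have "\<forall>k. (w k - xbar) /\<^sub>R norm (w k - xbar) \<in> sphere 0 1"
      using w_ne by simp
    then obtain d s where d: "d \<in> sphere 0 1" and s: "strict_mono s"
      and ds: "((\<lambda>k. (w k - xbar) /\<^sub>R norm (w k - xbar)) \<circ> s) \<longlonglongrightarrow> d"
      by (rule seq_compactE[OF compact_imp_seq_compact[OF compact_sphere]])
    define x where "x k = w (s k)" for k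
    define t where "t k = norm (x k - xbar)" for k
    have x_ne: "x k \<noteq> xbar" and t_pos: "t k > 0" and FxD: "F (x k) \<in> D" for k
      using w_ne w(1)[of "s k"] by (auto simp: x_def t_def X_eq feasible_set_def)
    have dir: "(\<lambda>k. (x k - xbar) /\<^sub>R t k) \<longlonglongrightarrow> d"
      using ds by (simp add: x_def t_def o_def)
    have cs: "(\<lambda>k. c (s k)) \<longlonglongrightarrow> 0"
      using LIMSEQ_subseq_LIMSEQ[OF c_lim s] by (simp add: o_def)
    have t_lim: "t \<longlonglongrightarrow> 0"
      by (rule Lim_null_comparison[OF _ cs]) (simp add: t_def x_def w(2))
    then have x_lim: "x \<longlonglongrightarrow> xbar"
      unfolding t_def by (simp add: tendsto_norm_zero_iff LIM_zero_iff)
    have fx: "f (x k) < f xbar + c (s k) * (t k)\<^sup>2" for k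
      using w(3) by (simp add: x_def t_def)
    obtain F' where F': "(F has_derivative F') (at xbar)"
      using F_C2 by (rule twice_continuously_differentiable_imp_has_derivative)
    \<comment> \<open>With multiplier 0 the Lagrangian is \<open>f\<close> itself.\<close>
    have f': "GDERIV f xbar :> gradient f xbar"
      using twice_continuously_differentiable_lagrangian(1)[OF f_C2 F_C2, of 0 xbar]
      by (simp add: lagrangian_def)
    have "(F has_derivative (\<lambda>h. jacobian F (at xbar) *v h)) (at xbar)"
      using F' by (metis jacobian_works differentiable_def)
    from fun_cong[OF has_derivative_unique[OF this F'], of d]
    have "jacobian F (at xbar) *v d = F' d" .
    moreover have "(\<lambda>k. (F (x k) - F xbar) /\<^sub>R t k) \<longlonglongrightarrow> F' d"
      using directional_difference_quotient_tendsto[OF F' x_lim x_ne dir[unfolded t_def]]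
      by (simp add: t_def)
    \<comment> \<open>With the difference quotients of \<open>F\<close> as directions, the point
      reached is exactly \<open>F (x k)\<close>.\<close>
    moreover have "F xbar + t k *\<^sub>R ((F (x k) - F xbar) /\<^sub>R t k) \<in> D" for k
      using t_pos[of k] FxD by simp
    ultimately have d_lin: "d \<in> linearization_cone F D xbar"
      unfolding linearization_cone_def tangent_cone_def mem_Collect_eq
      using t_pos t_lim by (intro exI[of _ t] exI[of _ "\<lambda>k. (F (x k) - F xbar) /\<^sub>R t k"]) simp
    have "(\<lambda>k. (f (x k) - f xbar) /\<^sub>R t k) \<longlonglongrightarrow> d \<bullet> gradient f xbar"
      using directional_difference_quotient_tendsto[OF f'[unfolded gderiv_def] x_lim x_ne
        dir[unfolded t_def]] by (simp add: t_def)
    moreover have "(\<lambda>k. c (s k) * t k) \<longlonglongrightarrow> 0"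
      using tendsto_mult[OF cs t_lim] by simp
    \<comment> \<open>The violated growth bound divided by \<open>t k\<close>; its right side
      vanishes in the limit.\<close>
    moreover have "\<forall>k\<ge>0. (f (x k) - f xbar) /\<^sub>R t k \<le> c (s k) * t k"
    proof (intro allI impI)
      fix k :: nat
      show "(f (x k) - f xbar) /\<^sub>R t k \<le> c (s k) * t k"
        using fx[of k] t_pos[of k] by (simp add: field_simps power2_eq_square)
    qed
    ultimately have "d \<bullet> gradient f xbar \<le> 0"
      by (blast intro: LIMSEQ_le)
    with d_lin d have "d \<in> critical_cone f F D xbar - {0}"
      by (auto simp: critical_cone_def inner_commute)
    with SOSC obtain \<mu> where \<mu>: "\<mu> \<in> S_multipliers f F Ds r xbar"
      and pos: "d \<bullet> (hessian (\<lambda>x. lagrangian f F x \<mu>) xbar *v d) > 0"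
      by blast
    define L where "L = (\<lambda>z. lagrangian f F z \<mu>)"
    define H where "H = (\<lambda>h. hessian L xbar *v h)"
    have L': "\<And>z. GDERIV L z :> gradient L z" and "gradient L differentiable at xbar"
      unfolding L_def by (rule twice_continuously_differentiable_lagrangian[OF f_C2 F_C2])+
    then have H: "(gradient L has_derivative H) (at xbar)"
      unfolding H_def hessian_def by (simp add: jacobian_works)
    have crit: "gradient L xbar = 0"
      using \<mu> by (simp add: S_multipliers_def L_def)
    \<comment> \<open>Why 8: the normalised curvature tends to \<open>8 * e\<close>, so it
      eventually exceeds \<open>4 * e\<close>. Halved and reduced by the expansion error
      \<open>e\<close>, it still leaves an increase of \<open>L\<close> above
      \<open>e * (t k)\<^sup>2\<close>, while \<open>c (s k) < e\<close> forces it below.\<close>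
    define e where "e = d \<bullet> H d / 8"
    have "e > 0"
      using pos by (simp add: e_def H_def L_def)
    from second_order_expansion_at_critical_point[OF L' crit H this] obtain \<delta> where \<delta>: "\<delta> > 0"
      "\<And>z. norm (z - xbar) < \<delta> \<Longrightarrow>
        \<bar>L z - L xbar - ((z - xbar) \<bullet> H (z - xbar)) / 2\<bar> \<le> e * (norm (z - xbar))\<^sup>2"
      by blast
    have H_lin: "bounded_linear H"
      using H by (rule has_derivative_bounded_linear)
    have ev_active: "\<forall>\<^sub>F k in sequentially. \<exists>i\<in>active_indices F Ds r xbar. F (x k) \<in> Ds i"
    proof -
      have F_lim: "(\<lambda>k. F (x k)) \<longlonglongrightarrow> F xbar"
        using isCont_tendsto_compose[OF has_derivative_continuous[OF F'] x_lim] .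
      \<comment> \<open>The complement of an inactive piece is an open neighbourhood of
        \<open>F xbar\<close>. Finitely many pieces are left simultaneously, so the piece containing
        \<open>F (x k)\<close> is eventually an active one.\<close>
      have "\<forall>\<^sub>F k in sequentially. F (x k) \<notin> Ds i"
        if "i \<in> {1..r}" "F xbar \<notin> Ds i" for i
        using topological_tendstoD[OF F_lim, of "- Ds i"] that polyhedral
        by (auto simp: open_Compl polyhedron_imp_closed)
      then have "\<forall>\<^sub>F k in sequentially. \<forall>i\<in>{1..r}. F xbar \<notin> Ds i \<longrightarrow> F (x k) \<notin> Ds i"
        by (intro eventually_ball_finite) (auto simp del: atLeastAtMost_iff)
      then show ?thesis
        by eventually_elim (use FxD in \<open>unfold active_indices_def D_eq, blast\<close>)
    qed
    have "(\<lambda>k. ((x k - xbar) /\<^sub>R t k) \<bullet> H ((x k - xbar) /\<^sub>R t k)) \<longlonglongrightarrow> d \<bullet> H d"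
      by (intro tendsto_inner dir bounded_linear.tendsto[OF H_lin])
    then have ev_curv: "\<forall>\<^sub>F k in sequentially. ((x k - xbar) /\<^sub>R t k) \<bullet> H ((x k - xbar) /\<^sub>R t k) > 4 * e"
      using \<open>e > 0\<close> by (intro order_tendstoD) (auto simp: e_def)
    have ev_t: "\<forall>\<^sub>F k in sequentially. t k < \<delta>"
      using t_lim \<delta>(1) by (rule order_tendstoD)
    have ev_c: "\<forall>\<^sub>F k in sequentially. c (s k) < e"
      using cs \<open>e > 0\<close> by (rule order_tendstoD)
    have "\<forall>\<^sub>F k in sequentially. False"
      using ev_active ev_curv ev_t ev_c
    proof eventually_elim
      case (elim k)
      obtain i where i: "i \<in> active_indices F Ds r xbar" "F (x k) \<in> Ds i"
        using elim(1) by blast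
      then have "convex (Ds i)" "F xbar \<in> Ds i"
        using polyhedral by (auto simp: active_indices_def intro: polyhedron_imp_convex)
      \<comment> \<open>The index \<open>i\<close> may change with \<open>k\<close>:
        \<open>\<mu>\<close> is normal to every active piece, so the sign is the same whichever
        piece is met.\<close>
      then have "\<mu> \<bullet> (F (x k) - F xbar) \<le> 0"
        using \<mu> i tangent_cone_convex unfolding S_multipliers_def frechet_normal_cone_def by blast
      then have "L (x k) - L xbar \<le> f (x k) - f xbar"
        by (simp add: L_def lagrangian_def inner_commute inner_diff_right)
      also have "\<dots> < c (s k) * (t k)\<^sup>2"
        using fx[of k] by simp
      also have "\<dots> < e * (t k)\<^sup>2"
        using elim(4) t_pos[of k] by simp
      finally have upper: "L (x k) - L xbar < e * (t k)\<^sup>2" .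
      \<comment> \<open>The quadratic form is homogeneous of degree two, which carries the bound on
        normalised steps over to the actual ones.\<close>
      have "(x k - xbar) \<bullet> H (x k - xbar) =
          (((x k - xbar) /\<^sub>R t k) \<bullet> H ((x k - xbar) /\<^sub>R t k)) * (t k)\<^sup>2"
        using t_pos[of k]
        by (simp add: linear_simps(5)[OF H_lin]) (simp add: power2_eq_square field_simps)
      also have "\<dots> > (4 * e) * (t k)\<^sup>2"
        using elim(2) t_pos[of k] by (intro mult_strict_right_mono) auto
      finally have "(x k - xbar) \<bullet> H (x k - xbar) > 4 * (e * (t k)\<^sup>2)"
        by simp
      moreover have "\<bar>L (x k) - L xbar - ((x k - xbar) \<bullet> H (x k - xbar)) / 2\<bar> \<le> e * (t k)\<^sup>2"
        using \<delta>(2)[of "x k"] elim(3) by (simp add: t_def)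
      ultimately show False
        using upper by linarith
    qed
    then show False
      by simp
  qed
  with quadratic_growth_imp_strict_local_minimizer[OF xbar_feasible] show ?thesis
    by blast
qed

end
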